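(* Let $(\mathfrak g,\diamond)$ be a Novikov algebra over $\mathbb K$, $(M;l,r)$ a representation of $\mathfrak g$, and $\kappa,\kappa':\mathfrak g\otimes\mathfrak g\to M$ two $2$-cocycles of $\mathfrak g$ with coefficients in $(M;l,r)$. The abelian extensions $\mathfrak g\oplus_{l,r,\kappa}M$ and $\mathfrak g\oplus_{l,r,\kappa'}M$ of $\mathfrak g$ by $M$ are isomorphic if and only if $\kappa$ and $\kappa'$ are in the same cohomology class in $\mathcal H^2_{\mathrm{Nov}}(\mathfrak g;M)$.
   Context: $\mathbb K$ is a field of characteristic $0$. A (left) Novikov algebra is a vector space $\mathfrak g$ with a bilinear operation $\diamond$ satisfying $(x\diamond y)\diamond z-x\diamond(y\diamond z)=(y\diamond x)\diamond z-y\diamond(x\diamond z)$ and $(x\diamond y)\diamond z=(x\diamond z)\diamond y$. A representation $(M;l,r)$ is a vector space $M$ with $l,r\in\mathrm{Hom}(\mathfrak g\otimes M,M)$ such that for all $x,y\in\mathfrak g$, $m\in M$, writing $l_x m=l(x\otimes m)$, $r_xm=r(x\otimes m)$: $l_{x\diamond y}m-l_{y\diamond x}m=l_xl_ym-l_yl_xm$; $\ l_xr_ym-r_yl_xm=r_{x\diamond y}m-r_yr_xm$; $\ l_{x\diamond y}m=r_yl_xm$; $\ r_xr_ym=r_yr_xm$. Extensions: an extension of $\mathfrak g$ by $M$ is an exact sequence $0\to M\xrightarrow{\iota}\hat{\mathfrak g}\xrightarrow{\pi}\mathfrak g\to0$ of Novikov algebra homomorphisms; it is abelian if the product of $\hat{\mathfrak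 g}$ vanishes on $M\times M$. Two extensions $\hat{\mathfrak g},\hat{\mathfrak g}'$ of $\mathfrak g$ by $M$ are isomorphic if there is a Novikov algebra isomorphism $\gamma:\hat{\mathfrak g}\to\hat{\mathfrak g}'$ with $\gamma\circ\iota=\iota'$ and $\pi'\circ\gamma=\pi$. For a $2$-cocycle $\kappa$, $\mathfrak g\oplus_{l,r,\kappa}M$ is the vector space $\mathfrak g\oplus M$ with Novikov product $(x+m)\bullet(y+u)=x\diamond y+l(x\otimes u)+r(y\otimes m)+\kappa(x,y)$, regarded as an extension via the canonical inclusion of $M$ and projection onto $\mathfrak g$. (Every abelian extension of $\mathfrak g$ by $M$ is, after choice of a linear section, of this form.) Low-degree part of the Novikov complex with coefficients in $M$: for $f\in\mathrm{Hom}(\mathfrak g,M)$, $\hat d^1(f)(x,y)=l_xf(y)+r_yf(x)-f(x\diamond y)$; for $f\in\mathrm{Hom}(\mathfrak g\otimes\mathfrak g,M)$, $\hat d^2(f)$ has the two components $$(\hat d^{(1,1)}_{(1,0,2)}f)(x_1;x_2,x_3)=r_{x_2}f(x_1,x_3)-r_{x_3}f(x_1,x_2)-f(x_1\diamond x_2,x_3)+f(x_1\diamond x_3,x_2),$$ $$\begin{aligned}(\hat d^{(1,1)}_{(0,2,1)}f)(x_1,x_2;x_3)={}&l_{x_1}f(x_2,x_3)-l_{x_2}f(x_1,x_3)-r_{x_3}f(x_1,x_2)+r_{x_3}f(x_2,x_1)\\&-f(x_1\diamond x_2,x_3)+f(x_2\diamond x_1,x_3)-f(x_2,x_1\diamond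 x_3)+f(x_1,x_2\diamond x_3).\end{aligned}$$ A $2$-cocycle is an element of $\ker\hat d^2$, and $\mathcal H^2_{\mathrm{Nov}}(\mathfrak g;M)=\ker\hat d^2/\operatorname{im}\hat d^1$. *)

theory Defs
  imports "HOL-Analysis.Product_Vector" "HOL-Library.Function_Algebras"
begin

section \<open>Novikov algebras and representations\<close>

text \<open>Linear maps on a tensor product are given as bilinear maps.\<close>

definition bilinear_map ::
  "('k::field \<Rightarrow> 'a::ab_group_add \<Rightarrow> 'a) \<Rightarrow> ('k \<Rightarrow> 'b::ab_group_add \<Rightarrow> 'b)
    \<Rightarrow> ('k \<Rightarrow> 'c::ab_group_add \<Rightarrow> 'c) \<Rightarrow> ('a \<Rightarrow> 'b \<Rightarrow> 'c) \<Rightarrow> bool" where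
  "bilinear_map s1 s2 s3 f \<longleftrightarrow>
     (\<forall>y. Vector_Spaces.linear s1 s3 (\<lambda>x. f x y)) \<and>
     (\<forall>x. Vector_Spaces.linear s2 s3 (\<lambda>y. f x y))"

locale novikov_algebra = vector_space scale
  for scale :: "'k::field \<Rightarrow> 'g::ab_group_add \<Rightarrow> 'g" +
  fixes mult :: "'g \<Rightarrow> 'g \<Rightarrow> 'g" (infixl "\<diamondop>" 70)
  assumes bilinear: "bilinear_map scale scale scale mult"
    and left_symmetric:
      "(x \<diamondop> y) \<diamondop> z - x \<diamondop> (y \<diamondop> z) = (y \<diamondop> x) \<diamondop> z - y \<diamondop> (x \<diamondop> z)"
    and right_commutative: "(x \<diamondop> y) \<diamondop> z = (x \<diamondop> z) \<diamondop> y"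

definition novikov_hom ::
  "('k::field \<Rightarrow> 'a::ab_group_add \<Rightarrow> 'a) \<Rightarrow> ('a \<Rightarrow> 'a \<Rightarrow> 'a)
    \<Rightarrow> ('k \<Rightarrow> 'b::ab_group_add \<Rightarrow> 'b) \<Rightarrow> ('b \<Rightarrow> 'b \<Rightarrow> 'b) \<Rightarrow> ('a \<Rightarrow> 'b) \<Rightarrow> bool" where
  "novikov_hom sA mA sB mB f \<longleftrightarrow>
     Vector_Spaces.linear sA sB f \<and> (\<forall>x y. f (mA x y) = mB (f x) (f y))"

locale novikov_representation = novikov_algebra sG mult + M: vector_space sM
  for sG :: "'k::field \<Rightarrow> 'g::ab_group_add \<Rightarrow> 'g"
    and mult :: "'g \<Rightarrow> 'g \<Rightarrow> 'g" (infixl "\<diamondop>" 70)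
    and sM :: "'k \<Rightarrow> 'm::ab_group_add \<Rightarrow> 'm" +
  fixes l r :: "'g \<Rightarrow> 'm \<Rightarrow> 'm"
  assumes l_bilinear: "bilinear_map sG sM sM l"
    and r_bilinear: "bilinear_map sG sM sM r"
    and l_commutator: "l (x \<diamondop> y) m - l (y \<diamondop> x) m = l x (l y m) - l y (l x m)"
    and l_r_commutator: "l x (r y m) - r y (l x m) = r (x \<diamondop> y) m - r y (r x m)"
    and l_mult: "l (x \<diamondop> y) m = r y (l x m)"
    and r_commute: "r x (r y m) = r y (r x m)"

section \<open>Extensions\<close>

record ('k, 'e, 'g, 'm) extension =
  ext_scale :: "'k \<Rightarrow> 'e \<Rightarrow> 'e"
  ext_mult :: "'e \<Rightarrow> 'e \<Rightarrow> 'e"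
  incl :: "'m \<Rightarrow> 'e"
  proj :: "'e \<Rightarrow> 'g"

definition is_extension ::
  "('k::field \<Rightarrow> 'g::ab_group_add \<Rightarrow> 'g) \<Rightarrow> ('g \<Rightarrow> 'g \<Rightarrow> 'g)
    \<Rightarrow> ('k \<Rightarrow> 'm::ab_group_add \<Rightarrow> 'm) \<Rightarrow> ('m \<Rightarrow> 'm \<Rightarrow> 'm)
    \<Rightarrow> ('k, 'e::ab_group_add, 'g, 'm) extension \<Rightarrow> bool" where
  "is_extension sG mG sM mM E \<longleftrightarrow>
     novikov_algebra sG mG \<and> novikov_algebra sM mM \<and>
     novikov_algebra (ext_scale E) (ext_mult E) \<and>
     novikov_hom sM mM (ext_scale E) (ext_mult E) (incl E) \<and>
     novikov_hom (ext_scale E) (ext_mult E) sG mG (proj E) \<and>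
     inj (incl E) \<and> range (incl E) = {e. proj E e = 0} \<and> surj (proj E)"

text \<open>For an abelian extension the algebra structure on the kernel is necessarily the zero
  product, so the kernel enters only as a vector space.\<close>

definition is_abelian_extension ::
  "('k::field \<Rightarrow> 'g::ab_group_add \<Rightarrow> 'g) \<Rightarrow> ('g \<Rightarrow> 'g \<Rightarrow> 'g)
    \<Rightarrow> ('k \<Rightarrow> 'm::ab_group_add \<Rightarrow> 'm)
    \<Rightarrow> ('k, 'e::ab_group_add, 'g, 'm) extension \<Rightarrow> bool" where
  "is_abelian_extension sG mG sM E \<longleftrightarrow>
     is_extension sG mG sM (\<lambda>_ _. 0) E \<and> (\<forall>u v. ext_mult E (incl E u) (incl E v) = 0)"

definition isomorphic_extensions ::
  "('k::field, 'e::ab_group_add, 'g, 'm) extension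
    \<Rightarrow> ('k, 'f::ab_group_add, 'g, 'm) extension \<Rightarrow> bool" where
  "isomorphic_extensions E E' \<longleftrightarrow>
     (\<exists>\<gamma>. novikov_hom (ext_scale E) (ext_mult E) (ext_scale E') (ext_mult E') \<gamma> \<and> bij \<gamma> \<and>
          \<gamma> \<circ> incl E = incl E' \<and> proj E' \<circ> \<gamma> = proj E)"

text \<open>The extension \<open>\<gg> \<oplus>\<^bsub>l,r,\<kappa>\<^esub> M\<close>; the pair \<open>(x, m)\<close> stands for \<open>x + m\<close>.\<close>

definition cocycle_extension ::
  "('k::field \<Rightarrow> 'g::ab_group_add \<Rightarrow> 'g) \<Rightarrow> ('g \<Rightarrow> 'g \<Rightarrow> 'g)
    \<Rightarrow> ('k \<Rightarrow> 'm::ab_group_add \<Rightarrow> 'm) \<Rightarrow> ('g \<Rightarrow> 'm \<Rightarrow> 'm) \<Rightarrow> ('g \<Rightarrow> 'm \<Rightarrow> 'm)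
    \<Rightarrow> ('g \<Rightarrow> 'g \<Rightarrow> 'm) \<Rightarrow> ('k, 'g \<times> 'm, 'g, 'm) extension" where
  "cocycle_extension sG mG sM l r \<kappa> =
     \<lparr> ext_scale = module_prod.scale sG sM,
       ext_mult = (\<lambda>(x, m) (y, u). (mG x y, l x u + r y m + \<kappa> x y)),
       incl = (\<lambda>m. (0, m)),
       proj = fst \<rparr>"

section \<open>The Novikov complex in low degree\<close>

definition d1 ::
  "('g \<Rightarrow> 'g \<Rightarrow> 'g) \<Rightarrow> ('g \<Rightarrow> 'm::ab_group_add \<Rightarrow> 'm) \<Rightarrow> ('g \<Rightarrow> 'm \<Rightarrow> 'm)
    \<Rightarrow> ('g \<Rightarrow> 'm) \<Rightarrow> ('g \<Rightarrow> 'g \<Rightarrow> 'm)" where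
  "d1 mG l r f = (\<lambda>x y. l x (f y) + r y (f x) - f (mG x y))"

definition d2_102 ::
  "('g \<Rightarrow> 'g \<Rightarrow> 'g) \<Rightarrow> ('g \<Rightarrow> 'm::ab_group_add \<Rightarrow> 'm) \<Rightarrow> ('g \<Rightarrow> 'm \<Rightarrow> 'm)
    \<Rightarrow> ('g \<Rightarrow> 'g \<Rightarrow> 'm) \<Rightarrow> ('g \<Rightarrow> 'g \<Rightarrow> 'g \<Rightarrow> 'm)" where
  "d2_102 mG l r f = (\<lambda>x1 x2 x3.
     r x2 (f x1 x3) - r x3 (f x1 x2) - f (mG x1 x2) x3 + f (mG x1 x3) x2)"

definition d2_021 ::
  "('g \<Rightarrow> 'g \<Rightarrow> 'g) \<Rightarrow> ('g \<Rightarrow> 'm::ab_group_add \<Rightarrow> 'm) \<Rightarrow> ('g \<Rightarrow> 'm \<Rightarrow> 'm)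
    \<Rightarrow> ('g \<Rightarrow> 'g \<Rightarrow> 'm) \<Rightarrow> ('g \<Rightarrow> 'g \<Rightarrow> 'g \<Rightarrow> 'm)" where
  "d2_021 mG l r f = (\<lambda>x1 x2 x3.
     l x1 (f x2 x3) - l x2 (f x1 x3) - r x3 (f x1 x2) + r x3 (f x2 x1)
     - f (mG x1 x2) x3 + f (mG x2 x1) x3 - f x2 (mG x1 x3) + f x1 (mG x2 x3))"

definition d2 ::
  "('g \<Rightarrow> 'g \<Rightarrow> 'g) \<Rightarrow> ('g \<Rightarrow> 'm::ab_group_add \<Rightarrow> 'm) \<Rightarrow> ('g \<Rightarrow> 'm \<Rightarrow> 'm)
    \<Rightarrow> ('g \<Rightarrow> 'g \<Rightarrow> 'm) \<Rightarrow> ('g \<Rightarrow> 'g \<Rightarrow> 'g \<Rightarrow> 'm) \<times> ('g \<Rightarrow> 'g \<Rightarrow> 'g \<Rightarrow> 'm)" where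
  "d2 mG l r f = (d2_102 mG l r f, d2_021 mG l r f)"

definition cocycles2 ::
  "('k::field \<Rightarrow> 'g::ab_group_add \<Rightarrow> 'g) \<Rightarrow> ('g \<Rightarrow> 'g \<Rightarrow> 'g)
    \<Rightarrow> ('k \<Rightarrow> 'm::ab_group_add \<Rightarrow> 'm) \<Rightarrow> ('g \<Rightarrow> 'm \<Rightarrow> 'm) \<Rightarrow> ('g \<Rightarrow> 'm \<Rightarrow> 'm)
    \<Rightarrow> ('g \<Rightarrow> 'g \<Rightarrow> 'm) set" where
  "cocycles2 sG mG sM l r = {f. bilinear_map sG sG sM f \<and> d2 mG l r f = 0}"

definition coboundaries2 ::
  "('k::field \<Rightarrow> 'g::ab_group_add \<Rightarrow> 'g) \<Rightarrow> ('g \<Rightarrow> 'g \<Rightarrow> 'g)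
    \<Rightarrow> ('k \<Rightarrow> 'm::ab_group_add \<Rightarrow> 'm) \<Rightarrow> ('g \<Rightarrow> 'm \<Rightarrow> 'm) \<Rightarrow> ('g \<Rightarrow> 'm \<Rightarrow> 'm)
    \<Rightarrow> ('g \<Rightarrow> 'g \<Rightarrow> 'm) set" where
  "coboundaries2 sG mG sM l r = d1 mG l r ` {f. Vector_Spaces.linear sG sM f}"

definition cohomologous2 ::
  "('k::field \<Rightarrow> 'g::ab_group_add \<Rightarrow> 'g) \<Rightarrow> ('g \<Rightarrow> 'g \<Rightarrow> 'g)
    \<Rightarrow> ('k \<Rightarrow> 'm::ab_group_add \<Rightarrow> 'm) \<Rightarrow> ('g \<Rightarrow> 'm \<Rightarrow> 'm) \<Rightarrow> ('g \<Rightarrow> 'm \<Rightarrow> 'm)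
    \<Rightarrow> (('g \<Rightarrow> 'g \<Rightarrow> 'm) \<times> ('g \<Rightarrow> 'g \<Rightarrow> 'm)) set" where
  "cohomologous2 sG mG sM l r =
     {(f, g). f \<in> cocycles2 sG mG sM l r \<and> g \<in> cocycles2 sG mG sM l r \<and>
              f - g \<in> coboundaries2 sG mG sM l r}"

definition H2_Nov ::
  "('k::field \<Rightarrow> 'g::ab_group_add \<Rightarrow> 'g) \<Rightarrow> ('g \<Rightarrow> 'g \<Rightarrow> 'g)
    \<Rightarrow> ('k \<Rightarrow> 'm::ab_group_add \<Rightarrow> 'm) \<Rightarrow> ('g \<Rightarrow> 'm \<Rightarrow> 'm) \<Rightarrow> ('g \<Rightarrow> 'm \<Rightarrow> 'm)
    \<Rightarrow> ('g \<Rightarrow> 'g \<Rightarrow> 'm) set set" where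
  "H2_Nov sG mG sM l r = cocycles2 sG mG sM l r // cohomologous2 sG mG sM l r"

section \<open>Well-definedness\<close>

lemma bilinear_map_iff:
  "bilinear_map s1 s2 s3 f \<longleftrightarrow>
     vector_space s1 \<and> vector_space s2 \<and> vector_space s3 \<and>
     (\<forall>x x' y. f (x + x') y = f x y + f x' y) \<and> (\<forall>c x y. f (s1 c x) y = s3 c (f x y)) \<and>
     (\<forall>x y y'. f x (y + y') = f x y + f x y') \<and> (\<forall>c x y. f x (s2 c y) = s3 c (f x y))"
  unfolding bilinear_map_def Vector_Spaces.linear_iff by blast

context novikov_representation
begin

lemma bilin_simps:
  "(x + x') \<diamondop> y = x \<diamondop> y + x' \<diamondop> y" "x \<diamondop> (y + y') = x \<diamondop> y + x \<diamondop> y'"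
  "sG c x \<diamondop> y = sG c (x \<diamondop> y)" "x \<diamondop> sG c y = sG c (x \<diamondop> y)"
  "l (x + x') m = l x m + l x' m" "l x (m + m') = l x m + l x m'"
  "l (sG c x) m = sM c (l x m)" "l x (sM c m) = sM c (l x m)"
  "r (x + x') m = r x m + r x' m" "r x (m + m') = r x m + r x m'"
  "r (sG c x) m = sM c (r x m)" "r x (sM c m) = sM c (r x m)"
  using bilinear l_bilinear r_bilinear unfolding bilinear_map_iff by simp_all

lemma zero_simps:
  "0 \<diamondop> y = 0" "x \<diamondop> 0 = 0" "l 0 m = 0" "l x 0 = 0" "r 0 m = 0" "r x 0 = 0"
  using bilin_simps(1)[of 0 0 y] bilin_simps(2)[of x 0 0] bilin_simps(5)[of 0 0 m]
    bilin_simps(6)[of x 0 0] bilin_simps(9)[of 0 0 m] bilin_simps(10)[of x 0 0]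
  by simp_all

lemma diff_simps:
  "l x (m - m') = l x m - l x m'" "r x (m - m') = r x m - r x m'"
  using bilin_simps(6)[of x "m - m'" m'] bilin_simps(10)[of x "m - m'" m']
  by (simp_all add: algebra_simps)

definition "L_defect x y m = l (x \<diamondop> y) m - l (y \<diamondop> x) m - (l x (l y m) - l y (l x m))"

definition "R_defect x y m = l x (r y m) - r y (l x m) - (r (x \<diamondop> y) m - r y (r x m))"

lemma defects_zero: "L_defect x y m = 0" "R_defect x y m = 0"
  by (simp_all only: L_defect_def R_defect_def l_commutator l_r_commutator diff_self)

lemma coboundaries2_subset_cocycles2:
  "coboundaries2 sG mult sM l r \<subseteq> cocycles2 sG mult sM l r"
proof
  fix k assume "k \<in> coboundaries2 sG mult sM l r"
  then obtain f where f: "Vector_Spaces.linear sG sM f" and k: "k = d1 mult l r f"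
    by (auto simp: coboundaries2_def)
  have fa: "f (x + y) = f x + f y" and fs: "f (sG c x) = sM c (f x)" for x y c
    using f by (simp_all add: Vector_Spaces.linear_iff)
  have fd: "f (x - y) = f x - f y" for x y
    using fa[of "x - y" y] by (simp add: algebra_simps)
  have "bilinear_map sG sG sM k"
    unfolding bilinear_map_iff k d1_def
    using vector_space_axioms M.vector_space_axioms
    by (auto simp: bilin_simps fa fs algebra_simps M.scale_right_distrib M.scale_right_diff_distrib)
  moreover have "d2_102 mult l r k = 0"
  proof (intro ext)
    fix x y z
    have "f ((x \<diamondop> y) \<diamondop> z) = f ((x \<diamondop> z) \<diamondop> y)" by (simp only: right_commutative[of x y z])
    then show "d2_102 mult l r k x y z = 0 x y z"
      using r_commute[of y z "f x"]
      by (simp add: d2_102_def k d1_def bilin_simps diff_simps l_mult algebra_simps)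
  qed
  moreover have "d2_021 mult l r k = 0"
  proof (intro ext)
    fix x y z
    have "f ((x \<diamondop> y) \<diamondop> z) - f (x \<diamondop> (y \<diamondop> z)) = f ((y \<diamondop> x) \<diamondop> z) - f (y \<diamondop> (x \<diamondop> z))"
      using arg_cong[OF left_symmetric[of x y z], of f] by (simp add: fd)
    moreover have "d2_021 mult l r k x y z =
        - L_defect x y (f z) + R_defect x z (f y) - R_defect y z (f x)
        + (f ((x \<diamondop> y) \<diamondop> z) - f (x \<diamondop> (y \<diamondop> z)) - (f ((y \<diamondop> x) \<diamondop> z) - f (y \<diamondop> (x \<diamondop> z))))"
      by (simp add: d2_021_def k d1_def L_defect_def R_defect_def bilin_simps diff_simps
          fa algebra_simps)
    ultimately show "d2_021 mult l r k x y z = 0 x y z"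
      by (simp add: defects_zero)
  qed
  ultimately show "k \<in> cocycles2 sG mult sM l r"
    by (simp add: cocycles2_def d2_def zero_prod_def)
qed

lemma equiv_cohomologous2:
  "equiv (cocycles2 sG mult sM l r) (cohomologous2 sG mult sM l r)"
proof -
  let ?B = "coboundaries2 sG mult sM l r"
  have z: "0 \<in> ?B"
    unfolding coboundaries2_def
    using vector_space_axioms M.vector_space_axioms
    by (intro image_eqI[where x = "\<lambda>_. 0"])
       (auto simp: fun_eq_iff d1_def zero_simps Vector_Spaces.linear_iff)
  have d: "k - k' \<in> ?B" if kk: "k \<in> ?B" "k' \<in> ?B" for k k'
  proof -
    obtain f f' where f: "Vector_Spaces.linear sG sM f" "k = d1 mult l r f"
      and f': "Vector_Spaces.linear sG sM f'" "k' = d1 mult l r f'"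
      using kk unfolding coboundaries2_def by blast
    have "Vector_Spaces.linear sG sM (\<lambda>x. f x - f' x)"
      using f f' by (auto simp: Vector_Spaces.linear_iff M.scale_right_diff_distrib)
    moreover have "k - k' = d1 mult l r (\<lambda>x. f x - f' x)"
      by (auto simp: fun_eq_iff f f' d1_def diff_simps)
    ultimately show ?thesis
      unfolding coboundaries2_def by blast
  qed
  have m: "- k \<in> ?B" if "k \<in> ?B" for k
    using d[OF z that] by simp
  have a: "k + k' \<in> ?B" if "k \<in> ?B" "k' \<in> ?B" for k k'
    using d[OF that(1) m[OF that(2)]] by simp
  show ?thesis
  proof (intro equivI refl_onI symI transI)
    show "cohomologous2 sG mult sM l r \<subseteq> cocycles2 sG mult sM l r \<times> cocycles2 sG mult sM l r"
      by (auto simp: cohomologous2_def)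
  next
    fix f assume "f \<in> cocycles2 sG mult sM l r"
    then show "(f, f) \<in> cohomologous2 sG mult sM l r"
      using z by (simp add: cohomologous2_def)
  next
    fix f g assume "(f, g) \<in> cohomologous2 sG mult sM l r"
    then show "(g, f) \<in> cohomologous2 sG mult sM l r"
      using m[of "f - g"] by (simp add: cohomologous2_def)
  next
    fix f g h
    assume "(f, g) \<in> cohomologous2 sG mult sM l r" "(g, h) \<in> cohomologous2 sG mult sM l r"
    then show "(f, h) \<in> cohomologous2 sG mult sM l r"
      using a[of "f - g" "g - h"] by (simp add: cohomologous2_def)
  qed
qed

lemma cocycle_extension_is_abelian_extension:
  assumes k: "k \<in> cocycles2 sG mult sM l r"
  shows "is_abelian_extension sG mult sM (cocycle_extension sG mult sM l r k)"
proof -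
  interpret P: vector_space_prod sG sM ..
  have ka: "k (x + x') y = k x y + k x' y" "k x (y + y') = k x y + k x y'"
    "k (sG c x) y = sM c (k x y)" "k x (sG c y) = sM c (k x y)" for x x' y y' c
    using k unfolding cocycles2_def bilinear_map_iff by simp_all
  have k0: "k 0 y = 0" "k x 0 = 0" for x y
    using ka(1)[of 0 0 y] ka(2)[of x 0 0] by simp_all
  have k1: "r y (k x z) - r z (k x y) - k (x \<diamondop> y) z + k (x \<diamondop> z) y = 0" for x y z
    using k by (auto simp: cocycles2_def d2_def d2_102_def zero_prod_def fun_eq_iff)
  have k2: "l x (k y z) - l y (k x z) - r z (k x y) + r z (k y x)
     - k (x \<diamondop> y) z + k (y \<diamondop> x) z - k y (x \<diamondop> z) + k x (y \<diamondop> z) = 0" for x y z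
    using k by (auto simp: cocycles2_def d2_def d2_021_def zero_prod_def fun_eq_iff)
  let ?E = "cocycle_extension sG mult sM l r k"
  have N: "novikov_algebra (ext_scale ?E) (ext_mult ?E)"
  proof (intro_locales)
    show "vector_space (ext_scale ?E)"
      by (simp add: cocycle_extension_def P.p.vector_space_axioms)
    show "novikov_algebra_axioms (ext_scale ?E) (ext_mult ?E)"
    proof
      show "bilinear_map (ext_scale ?E) (ext_scale ?E) (ext_scale ?E) (ext_mult ?E)"
        using P.p.vector_space_axioms
        by (auto simp: bilinear_map_iff cocycle_extension_def P.scale_prod bilin_simps ka
            M.scale_right_distrib algebra_simps)
      fix a b c :: "'g \<times> 'm"
      obtain x m y u z w where [simp]: "a = (x, m)" "b = (y, u)" "c = (z, w)"
        by (metis surj_pair)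
      show "ext_mult ?E (ext_mult ?E a b) c - ext_mult ?E a (ext_mult ?E b c) =
            ext_mult ?E (ext_mult ?E b a) c - ext_mult ?E b (ext_mult ?E a c)"
      proof -
        have "(l (x \<diamondop> y) w + r z (l x u + r y m + k x y) + k (x \<diamondop> y) z)
            - (l x (l y w + r z u + k y z) + r (y \<diamondop> z) m + k x (y \<diamondop> z))
            - ((l (y \<diamondop> x) w + r z (l y m + r x u + k y x) + k (y \<diamondop> x) z)
               - (l y (l x w + r z m + k x z) + r (x \<diamondop> z) u + k y (x \<diamondop> z)))
          = L_defect x y w - R_defect x z u + R_defect y z m
            - (l x (k y z) - l y (k x z) - r z (k x y) + r z (k y x)
               - k (x \<diamondop> y) z + k (y \<diamondop> x) z - k y (x \<diamondop> z) + k x (y \<diamondop> z))"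
          by (simp add: L_defect_def R_defect_def bilin_simps algebra_simps)
        then show ?thesis
          using left_symmetric[of x y z]
          by (simp only: defects_zero k2) (simp add: cocycle_extension_def)
      qed
      show "ext_mult ?E (ext_mult ?E a b) c = ext_mult ?E (ext_mult ?E a c) b"
        using right_commutative[of x y z] k1[of y x z] r_commute[of y z m]
        by (simp add: cocycle_extension_def bilin_simps l_mult algebra_simps)
    qed
  qed
  have "novikov_algebra sM (\<lambda>_ _. 0)"
    by unfold_locales (auto simp: bilinear_map_iff M.vector_space_axioms)
  moreover have "novikov_hom sM (\<lambda>_ _. 0) (ext_scale ?E) (ext_mult ?E) (incl ?E)"
    using M.vector_space_axioms P.p.vector_space_axioms
    by (simp add: novikov_hom_def Vector_Spaces.linear_iff cocycle_extension_def
        P.scale_prod zero_simps k0 zero_prod_def)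
  moreover have "novikov_hom (ext_scale ?E) (ext_mult ?E) sG mult (proj ?E)"
    using vector_space_axioms P.p.vector_space_axioms
    by (simp add: novikov_hom_def Vector_Spaces.linear_iff cocycle_extension_def
        P.scale_prod split_beta P.scale_def)
  moreover have "inj (incl ?E)" "surj (proj ?E)"
    by (auto simp: cocycle_extension_def inj_on_def)
  moreover have "range (incl ?E) = {e. proj ?E e = 0}"
    by (force simp: cocycle_extension_def)
  moreover have "ext_mult ?E (incl ?E u) (incl ?E v) = 0" for u v
    by (simp add: cocycle_extension_def zero_simps k0 zero_prod_def)
  ultimately show ?thesis
    using N novikov_algebra_axioms
    unfolding is_abelian_extension_def is_extension_def by blast
qed

end

end

theory Submission
  imports Defs
begin

text \<open>An isomorphism of extensions that is the identity on \<open>M\<close> and over \<open>\<gg>\<close> is a shear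
  \<open>(x, m) \<mapsto> (x, m + f x)\<close> for a unique linear \<open>f\<close>. Such a shear is always bijective, and
  comparing the two products shows that it is multiplicative precisely when
  \<open>\<kappa> - \<kappa>' = d1 f\<close>.\<close>

definition shear :: "('g \<Rightarrow> 'm::ab_group_add) \<Rightarrow> 'g \<times> 'm \<Rightarrow> 'g \<times> 'm" where
  "shear f = (\<lambda>(x, m). (x, m + f x))"

lemma bij_shear: "bij (shear f)"
  by (rule o_bij[where g = "shear (\<lambda>x. - f x)"]) (auto simp: shear_def fun_eq_iff)

context novikov_representation
begin

text \<open>Bridge between the relation and its quotient: since \<open>cohomologous2\<close> is an
  equivalence relation on the cocycles, related cocycles share the class of the first, and members
  of one class are related.\<close>

lemma cohomologous2_iff_same_class:
  "(\<kappa>, \<kappa>') \<in> cohomologous2 sG mult sM l r \<longleftrightarrow>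
     (\<exists>c \<in> H2_Nov sG mult sM l r. \<kappa> \<in> c \<and> \<kappa>' \<in> c)"
proof
  assume k: "(\<kappa>, \<kappa>') \<in> cohomologous2 sG mult sM l r"
  then have "\<kappa> \<in> cocycles2 sG mult sM l r"
    by (simp add: cohomologous2_def)
  with k show "\<exists>c \<in> H2_Nov sG mult sM l r. \<kappa> \<in> c \<and> \<kappa>' \<in> c"
    unfolding H2_Nov_def
    by (blast intro: quotientI equiv_class_self[OF equiv_cohomologous2])
next
  assume "\<exists>c \<in> H2_Nov sG mult sM l r. \<kappa> \<in> c \<and> \<kappa>' \<in> c"
  then show "(\<kappa>, \<kappa>') \<in> cohomologous2 sG mult sM l r"
    unfolding H2_Nov_def using in_quotient_imp_in_rel[OF equiv_cohomologous2] by blast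
qed

text \<open>The identity part of a shear is linear, so only the summand \<open>f x\<close> carries a
  condition.\<close>

lemma linear_shear_iff:
  "Vector_Spaces.linear (module_prod.scale sG sM) (module_prod.scale sG sM) (shear f) \<longleftrightarrow>
     Vector_Spaces.linear sG sM f"
proof -
  interpret P: vector_space_prod sG sM ..
  show ?thesis
    using vector_space_axioms M.vector_space_axioms P.p.vector_space_axioms
    by (auto simp: Vector_Spaces.linear_iff shear_def P.scale_prod
        M.scale_right_distrib algebra_simps)
qed

lemma novikov_hom_shear_iff:
  "novikov_hom (ext_scale (cocycle_extension sG mult sM l r \<kappa>))
       (ext_mult (cocycle_extension sG mult sM l r \<kappa>))
       (ext_scale (cocycle_extension sG mult sM l r \<kappa>'))
       (ext_mult (cocycle_extension sG mult sM l r \<kappa>')) (shear f) \<longleftrightarrow>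
     Vector_Spaces.linear sG sM f \<and> \<kappa> - \<kappa>' = d1 mult l r f"
proof -
  \<comment> \<open>These are the \<open>M\<close>-components of the shear of a product and of the
    product of shears. The terms \<open>l x u\<close> and \<open>r y m\<close> cancel, so the
    condition depends on \<open>x\<close> and \<open>y\<close> alone.\<close>
  have "l x u + r y m + \<kappa> x y + f (x \<diamondop> y) = l x (u + f y) + r y (m + f x) + \<kappa>' x y \<longleftrightarrow>
      \<kappa> x y - \<kappa>' x y = l x (f y) + r y (f x) - f (x \<diamondop> y)" for x y m u
    by (simp only: bilin_simps) (auto simp: algebra_simps)
  then show ?thesis
    by (simp add: novikov_hom_def cocycle_extension_def linear_shear_iff)
       (simp add: shear_def d1_def fun_eq_iff)
qed

text \<open>Split \<open>(x, m)\<close> as \<open>(x, 0) + (0, m)\<close>: the second summand is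
  fixed, and the image of the first can differ from \<open>(x, 0)\<close> only in its
  \<open>M\<close>-component, which serves as \<open>f x\<close>.\<close>

lemma extension_map_eq_shear:
  assumes lin: "Vector_Spaces.linear (module_prod.scale sG sM) (module_prod.scale sG sM) \<gamma>"
    and incl: "\<And>m. \<gamma> (0, m) = (0, m)"
    and proj: "\<And>p. fst (\<gamma> p) = fst p"
  shows "\<gamma> = shear (\<lambda>x. snd (\<gamma> (x, 0)))"
proof (intro ext)
  fix p :: "'g \<times> 'm"
  obtain x m where p: "p = (x, m)"
    by (cases p)
  have "\<gamma> ((x, 0) + (0, m)) = \<gamma> (x, 0) + \<gamma> (0, m)"
    using lin unfolding Vector_Spaces.linear_iff by blast
  then show "\<gamma> p = shear (\<lambda>x. snd (\<gamma> (x, 0))) p"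
    using proj[of "(x, 0)"] by (simp add: p incl shear_def prod_eq_iff add.commute)
qed

text \<open>The linear maps \<open>f\<close> with
  \<open>d1 mult l r f = \<kappa> - \<kappa>'\<close> are exactly those whose shears are
  isomorphisms from the first extension to the second.\<close>

lemma isomorphic_cocycle_extensions_iff:
  "isomorphic_extensions (cocycle_extension sG mult sM l r \<kappa>)
       (cocycle_extension sG mult sM l r \<kappa>') \<longleftrightarrow>
     \<kappa> - \<kappa>' \<in> coboundaries2 sG mult sM l r"
  (is "isomorphic_extensions ?E ?E' \<longleftrightarrow> _")
proof
  assume "isomorphic_extensions ?E ?E'"
  then obtain \<gamma> where hom: "novikov_hom (ext_scale ?E) (ext_mult ?E) (ext_scale ?E') (ext_mult ?E') \<gamma>"
    and incl: "\<gamma> \<circ> incl ?E = incl ?E'" and proj: "proj ?E' \<circ> \<gamma> = proj ?E"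
    unfolding isomorphic_extensions_def by blast
  have "\<gamma> = shear (\<lambda>x. snd (\<gamma> (x, 0)))"
    using hom incl proj
    by (intro extension_map_eq_shear)
       (auto simp: novikov_hom_def cocycle_extension_def fun_eq_iff)
  then obtain f where "\<gamma> = shear f"
    by blast
  with hom show "\<kappa> - \<kappa>' \<in> coboundaries2 sG mult sM l r"
    by (auto simp: novikov_hom_shear_iff coboundaries2_def)
next
  assume "\<kappa> - \<kappa>' \<in> coboundaries2 sG mult sM l r"
  then obtain f where f: "Vector_Spaces.linear sG sM f" "\<kappa> - \<kappa>' = d1 mult l r f"
    by (auto simp: coboundaries2_def)
  \<comment> \<open>This makes the shear fix every \<open>(0, m)\<close>, as compatibility with the
    inclusions requires.\<close>
  have "f 0 = 0"
    using f(1) unfolding Vector_Spaces.linear_iff by (metis add_cancel_right_right)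
  then have "shear f \<circ> incl ?E = incl ?E'" "proj ?E' \<circ> shear f = proj ?E"
    by (auto simp: shear_def cocycle_extension_def fun_eq_iff)
  with f show "isomorphic_extensions ?E ?E'"
    unfolding isomorphic_extensions_def using novikov_hom_shear_iff bij_shear by blast
qed

end

theorem theorem6p5:
  fixes sG :: "'k::field_char_0 \<Rightarrow> 'g::ab_group_add \<Rightarrow> 'g"
    and mG :: "'g \<Rightarrow> 'g \<Rightarrow> 'g"
    and sM :: "'k \<Rightarrow> 'm::ab_group_add \<Rightarrow> 'm"
    and l r :: "'g \<Rightarrow> 'm \<Rightarrow> 'm"
    and \<kappa> \<kappa>' :: "'g \<Rightarrow> 'g \<Rightarrow> 'm"
  assumes "novikov_algebra sG mG"
    and "novikov_representation sG mG sM l r"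
    and "\<kappa> \<in> cocycles2 sG mG sM l r"
    and "\<kappa>' \<in> cocycles2 sG mG sM l r"
  shows "isomorphic_extensions (cocycle_extension sG mG sM l r \<kappa>)
           (cocycle_extension sG mG sM l r \<kappa>')
         \<longleftrightarrow> (\<exists>c \<in> H2_Nov sG mG sM l r. \<kappa> \<in> c \<and> \<kappa>' \<in> c)"
proof -
  interpret novikov_representation sG mG sM l r
    by fact
  show ?thesis
    \<comment> \<open>Membership in \<open>cohomologous2\<close> also demands that both maps be
      cocycles; these facts supply that, leaving only the condition on the difference.\<close>
    using assms(3,4)
    by (simp add: isomorphic_cocycle_extensions_iff cohomologous2_def
        flip: cohomologous2_iff_same_class)
qed

end
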